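(* For every real number $x\in[1,\infty)$, the following inequalities hold: $$\frac{x+\frac{5}{12}}{x+\frac{11}{12}}-\frac{5}{288x^{3}}+\frac{343}{8640x^{4}}-\frac{2621}{41472x^{5}}<\frac{1}{e}\left(1+\frac{1}{x}\right)^{x}<\frac{x+\frac{5}{12}}{x+\frac{11}{12}}-\frac{5}{288x^{3}}+\frac{343}{8640x^{4}}-\frac{2621}{41472x^{5}}+\frac{300901}{3483648x^{6}}.$$
   Context: Here $e$ is the base of the natural logarithm. *)

theory Defs
  imports Complex_Main
begin

end

theory Submission
  imports Defs
begin

text \<open>
  With \<open>t = 1/x\<close>, which ranges over \<open>(0, 1]\<close>, both bounds are the value at \<open>t\<close> of a rational
  function \<open>N(t) / (12 + 11 t)\<close>, and they differ only in a summand \<open>a t^6\<close>: \<open>a\<close> is \<open>0\<close>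
  in the lower bound and \<open>300901/3483648\<close> in the upper one. Taking logarithms and multiplying by
  \<open>t\<close>, comparing the bound with \<open>(1 + t) powr (1/t) / e\<close> amounts to finding the sign of
  \<open>f(t) = t * (ln (N(t)) - ln (12 + 11 t) + 1) - ln (1 + t)\<close>,
  called \<open>gap\<close> below. The multiplication by \<open>t\<close> is what makes the problem algebraic: the logarithms
  occur in \<open>f\<close> with polynomial coefficients of degree at most one, so that \<open>f''\<close> is a rational
  function. Moreover \<open>f(0) = f'(0) = 0\<close>, hence a constant sign of \<open>f''\<close> on \<open>(0, 1)\<close> is
  inherited by \<open>f\<close> (\<open>positive_if_second_derivative_positive\<close>).

  The denominator of \<open>f''\<close> is a square, and its numerator \<open>curvature_numer\<close> starts with
  \<open>(870912 a - 300901/4) t^5\<close>. For \<open>a = 0\<close> this term is negative and outweighs the few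
  positive terms, all of much higher degree and smaller size (\<open>curvature_numer_neg\<close>). The other
  value of \<open>a\<close> is exactly the one that cancels the term: it is the leading coefficient of the
  difference between the function and the lower bound. What remains starts with a positive
  multiple of \<open>t^6\<close>, which outweighs the single negative term (\<open>curvature_numer_pos\<close>).
\<close>

lemma positive_if_second_derivative_positive:
  fixes f f' f'' :: "real \<Rightarrow> real"
  assumes f: "\<And>t. 0 \<le> t \<Longrightarrow> t \<le> b \<Longrightarrow> (f has_real_derivative f' t) (at t)"
    and f': "\<And>t. 0 \<le> t \<Longrightarrow> t \<le> b \<Longrightarrow> (f' has_real_derivative f'' t) (at t)"
    and f'': "\<And>t. 0 < t \<Longrightarrow> t < b \<Longrightarrow> 0 < f'' t"
    and zero: "f 0 = 0" "f' 0 = 0"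
    and "0 < b"
  shows "0 < f b"
proof -
  have f'_pos: "0 < f' t" if t: "0 < t" "t < b" for t
  proof -
    have "f' 0 < f' t"
    proof (rule DERIV_pos_imp_increasing_open[OF t(1)])
      show "\<exists>y. DERIV f' s :> y \<and> 0 < y" if "0 < s" "s < t" for s
        using f'[of s] f''[of s] that t by auto
      show "continuous_on {0..t} f'"
        using f' t by (intro DERIV_atLeastAtMost_imp_continuous_on) force
    qed
    with zero show ?thesis by simp
  qed
  have "f 0 < f b"
  proof (rule DERIV_pos_imp_increasing_open[OF \<open>0 < b\<close>])
    show "\<exists>y. DERIV f s :> y \<and> 0 < y" if "0 < s" "s < b" for s
      using f[of s] f'_pos[of s] that by auto
    show "continuous_on {0..b} f"
      using f by (intro DERIV_atLeastAtMost_imp_continuous_on) force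
  qed
  with zero show ?thesis by simp
qed

text \<open>
  The numerator of the bound over the denominator \<open>12 + 11 t\<close>, as a function of \<open>t = 1/x\<close>. The
  parameter \<open>a\<close> is the coefficient of \<open>1/x^6\<close>, so that both bounds are instances.
\<close>

definition numer :: "real \<Rightarrow> real \<Rightarrow> real" where
  "numer a t = (12 + 5 * t) + (12 + 11 * t) *
     (- (5/288) * t^3 + 343/8640 * t^4 - 2621/41472 * t^5 + a * t^6)"

definition numer' :: "real \<Rightarrow> real \<Rightarrow> real" where
  "numer' a t = 5 + 11 * (- (5/288) * t^3 + 343/8640 * t^4 - 2621/41472 * t^5 + a * t^6)
     + (12 + 11 * t) * (- (5/96) * t^2 + 343/2160 * t^3 - 13105/41472 * t^4 + 6 * a * t^5)"

definition numer'' :: "real \<Rightarrow> real \<Rightarrow> real" where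
  "numer'' a t = 22 * (- (5/96) * t^2 + 343/2160 * t^3 - 13105/41472 * t^4 + 6 * a * t^5)
     + (12 + 11 * t) * (- (5/48) * t + 343/720 * t^2 - 13105/10368 * t^3 + 30 * a * t^4)"

lemma has_derivative_numer:
  "(numer a has_real_derivative numer' a t) (at t)"
  unfolding numer_def[abs_def] numer'_def
  by (auto intro!: derivative_eq_intros simp: field_simps eval_nat_numeral)

lemma has_derivative_numer':
  "(numer' a has_real_derivative numer'' a t) (at t)"
  unfolding numer'_def[abs_def] numer''_def
  by (auto intro!: derivative_eq_intros simp: field_simps eval_nat_numeral)

text \<open>
  The power terms lower the rational part \<open>(12 + 5 t) / (12 + 11 t)\<close> by at most \<open>1/2\<close> on
  the unit interval, where that part is at least \<open>17/23\<close>.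
\<close>

lemma numer_pos:
  assumes "0 \<le> a" "0 \<le> t" "t \<le> 1"
  shows "0 < numer a t"
proof -
  define p where "p = - (5/288) * t^3 + 343/8640 * t^4 - 2621/41472 * t^5 + a * t^6"
  have "t^3 \<le> 1" "t^5 \<le> 1"
    using assms by (auto intro: power_le_one)
  moreover have "0 \<le> t^4" "0 \<le> a * t^6"
    using assms by auto
  ultimately have "- (1/2) \<le> p" unfolding p_def by linarith
  then have "(12 + 11 * t) * (- (1/2)) \<le> (12 + 11 * t) * p"
    using assms by (intro mult_left_mono) auto
  then have "- 6 - 11/2 * t \<le> (12 + 11 * t) * p"
    by (simp add: algebra_simps)
  moreover have "numer a t = (12 + 5 * t) + (12 + 11 * t) * p"
    unfolding numer_def p_def ..
  ultimately show ?thesis using assms by linarith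
qed

text \<open>
  Up to the factor \<open>t\<close>, the logarithm of the quotient of the bound by
  \<open>(1 + t) powr (1/t) / e\<close> (see \<open>gap_inverse\<close>).
\<close>

definition gap :: "real \<Rightarrow> real \<Rightarrow> real" where
  "gap a t = t * (ln (numer a t) - ln (12 + 11 * t) + 1) - ln (1 + t)"

definition gap' :: "real \<Rightarrow> real \<Rightarrow> real" where
  "gap' a t = ln (numer a t) - ln (12 + 11 * t) + 1
     + t * (numer' a t / numer a t - 11 / (12 + 11 * t)) - 1 / (1 + t)"

text \<open>
  The numerator of the second derivative of \<open>gap\<close> over the denominator
  \<open>(numer a t * (12 + 11 * t) * (1 + t))^2\<close>, expanded in powers of \<open>t\<close> and sorted by powers of \<open>a\<close>.
  In this form all cancellation in low orders has been carried out and its sign can be read off.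
\<close>

definition curvature_numer :: "real \<Rightarrow> real \<Rightarrow> real" where
  "curvature_numer a t =
      (- (300901/4) * t^5 - 9903979/36 * t^6 - 8612511709/21600 * t^7 - 48990866351/172800 * t^8
       - 16701605479/172800 * t^9 - 72781775293/6220800 * t^10 + 54250854367/49766400 * t^11
       + 595556706107/223948800 * t^12 + 131625217759541/42998169600 * t^13 + 2669010133427/1719926784 * t^14
       + 502892069405/1719926784 * t^15)
     + a *
      (870912 * t^5 + 4644864 * t^6 + 10127808 * t^7 + 11502144 * t^8 + 35558934/5 * t^9
       + 11121878/5 * t^10 + 235261 * t^11 - 13977289/144 * t^12 - 142726309/864 * t^13
       - 2540135213/17280 * t^14 - 6674154421/103680 * t^15 - 38374061/3456 * t^16)
     + a^2 *
      (124416 * t^11 + 725760 * t^12 + 1740096 * t^13 + 2198592 * t^14 + 1545654 * t^15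
       + 573661 * t^16 + 87846 * t^17)"

definition gap'' :: "real \<Rightarrow> real \<Rightarrow> real" where
  "gap'' a t = curvature_numer a t / (numer a t * (12 + 11 * t) * (1 + t))^2"

lemma gap_at_0: "gap a 0 = 0" "gap' a 0 = 0"
  by (simp_all add: gap_def gap'_def numer_def)

lemma has_derivative_gap:
  assumes "0 \<le> a" "0 \<le> t" "t \<le> 1"
  shows "(gap a has_real_derivative gap' a t) (at t)"
proof -
  have pos: "0 < numer a t" by (rule numer_pos[OF assms])
  show ?thesis
    unfolding gap_def[abs_def] gap'_def using pos assms
    by (auto intro!: derivative_eq_intros has_derivative_numer
          simp: algebra_simps diff_divide_distrib add_divide_distrib)
qed

text \<open>
  The left-hand side is what one obtains by putting \<open>2 g' + t g'' + 1 / (1 + t)^2\<close> over the common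
  denominator, where \<open>g\<close> is the logarithm of \<open>numer a t / (12 + 11 * t)\<close>.
\<close>

lemma curvature_numer_eq:
  "2 * (numer' a t * numer a t * (12 + 11 * t)^2 - 11 * (12 + 11 * t) * (numer a t)^2) * (1 + t)^2
     + t * ((numer'' a t * numer a t - (numer' a t)^2) * (12 + 11 * t)^2 + 121 * (numer a t)^2) * (1 + t)^2
     + (numer a t * (12 + 11 * t))^2 = curvature_numer a t"
  unfolding numer_def numer'_def numer''_def curvature_numer_def
  by algebra

lemma has_derivative_gap':
  assumes "0 \<le> a" "0 \<le> t" "t \<le> 1"
  shows "(gap' a has_real_derivative gap'' a t) (at t)"
proof -
  have N: "0 < numer a t" by (rule numer_pos[OF assms])
  \<comment> \<open>The linear factors are kept opaque, so that clearing denominators does not expand them.\<close>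
  define D E where "D s = 12 + 11 * s" and "E s = 1 + s" for s :: real
  have D: "0 < D t" and E: "0 < E t" using assms by (auto simp: D_def E_def)
  have [derivative_intros]:
    "(D has_real_derivative 11) (at t)" "(E has_real_derivative 1) (at t)"
    unfolding D_def[abs_def] E_def[abs_def] by (auto intro!: derivative_eq_intros)
  have "((\<lambda>s. ln (numer a s) - ln (D s) + 1 + s * (numer' a s / numer a s - 11 / D s) - 1 / E s)
      has_real_derivative
      2 * (numer' a t / numer a t - 11 / D t)
      + t * ((numer'' a t * numer a t - (numer' a t)^2) / (numer a t)^2 + 121 / (D t)^2)
      + 1 / (E t)^2) (at t)"
    using N D E
    by (auto intro!: derivative_eq_intros has_derivative_numer has_derivative_numer'
          simp: field_simps power2_eq_square)
  also have "2 * (numer' a t / numer a t - 11 / D t)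
      + t * ((numer'' a t * numer a t - (numer' a t)^2) / (numer a t)^2 + 121 / (D t)^2)
      + 1 / (E t)^2
    = (2 * (numer' a t * numer a t * (D t)^2 - 11 * D t * (numer a t)^2) * (E t)^2
      + t * ((numer'' a t * numer a t - (numer' a t)^2) * (D t)^2 + 121 * (numer a t)^2) * (E t)^2
      + (numer a t * D t)^2) / (numer a t * D t * E t)^2"
    using N D E by (simp add: field_simps power2_eq_square)
  also have "\<dots> = gap'' a t"
    unfolding gap''_def curvature_numer_eq[symmetric] D_def E_def ..
  finally show ?thesis unfolding gap'_def[abs_def] D_def E_def .
qed

text \<open>
  The only positive coefficients belong to \<open>t^11\<close> up to \<open>t^15\<close>. Each of these powers is at most
  \<open>t^5\<close>, and their coefficients sum up to less than \<open>9000\<close>, whereas \<open>t^5\<close> has the coefficient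
  \<open>- 300901/4\<close>.
\<close>

lemma curvature_numer_neg:
  assumes "0 < t" "t \<le> 1"
  shows "curvature_numer 0 t < 0"
proof -
  have "0 < t^5" using assms by simp
  moreover have "0 \<le> t^k" for k using assms by simp
  note this[of 6] this[of 7] this[of 8] this[of 9] this[of 10]
  moreover have "t^11 \<le> t^5" "t^12 \<le> t^5" "t^13 \<le> t^5" "t^14 \<le> t^5" "t^15 \<le> t^5"
    using assms by (auto intro: power_decreasing)
  ultimately show ?thesis unfolding curvature_numer_def power2_eq_square by linarith
qed

text \<open>
  Here the coefficient of \<open>t^5\<close> vanishes, since \<open>300901/3483648 = (300901/4) / 870912\<close>. The only
  negative coefficient left is that of \<open>t^12\<close>, about \<open>- 310\<close>; the term is absorbed by that of
  \<open>t^6\<close>, whose coefficient exceeds \<open>126000\<close>.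
\<close>

lemma curvature_numer_pos:
  assumes "0 < t" "t \<le> 1"
  shows "0 < curvature_numer (300901/3483648) t"
proof -
  have "0 < t^6" using assms by simp
  moreover have "0 \<le> t^k" for k using assms by simp
  note this[of 7] this[of 8] this[of 9] this[of 10] this[of 11] this[of 13] this[of 14]
    this[of 15] this[of 16] this[of 17]
  moreover have "t^12 \<le> t^6"
    using assms by (intro power_decreasing) auto
  ultimately show ?thesis
    unfolding curvature_numer_def power2_eq_square distrib_left right_diff_distrib by linarith
qed

lemma gap_neg:
  assumes "0 < t" "t \<le> 1"
  shows "gap 0 t < 0"
proof -
  have "0 < - gap 0 t"
  proof (rule positive_if_second_derivative_positive
      [where f = "\<lambda>s. - gap 0 s" and f' = "\<lambda>s. - gap' 0 s" and f'' = "\<lambda>s. - gap'' 0 s"])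
    show "((\<lambda>t. - gap 0 t) has_real_derivative - gap' 0 s) (at s)" if "0 \<le> s" "s \<le> t" for s
      using that assms by (intro DERIV_minus has_derivative_gap) auto
    show "((\<lambda>t. - gap' 0 t) has_real_derivative - gap'' 0 s) (at s)" if "0 \<le> s" "s \<le> t" for s
      using that assms by (intro DERIV_minus has_derivative_gap') auto
    show "0 < - gap'' 0 s" if "0 < s" "s < t" for s
      using curvature_numer_neg[of s] numer_pos[of 0 s] that assms
      by (simp add: gap''_def divide_less_0_iff)
  qed (use assms gap_at_0 in auto)
  then show ?thesis by simp
qed

lemma gap_pos:
  assumes "0 < t" "t \<le> 1"
  shows "0 < gap (300901/3483648) t"
proof (rule positive_if_second_derivative_positive
    [where f = "gap (300901/3483648)" and f' = "gap' (300901/3483648)" and f'' = "gap'' (300901/3483648)"])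
  show "0 < gap'' (300901/3483648) s" if "0 < s" "s < t" for s
    using curvature_numer_pos[of s] numer_pos[of "300901/3483648" s] that assms
    by (simp add: gap''_def)
qed (use assms in \<open>auto intro: has_derivative_gap has_derivative_gap' gap_at_0\<close>)

text \<open>
  The translation back to \<open>x\<close>: the sign of \<open>gap a (1/x)\<close> decides on which side of the function
  the bound lies. Positivity of the bound is needed to remove the logarithms.
\<close>

lemma gap_inverse:
  assumes "1 \<le> x" "0 \<le> a"
  shows "gap a (1/x) = (ln ((x + 5/12) / (x + 11/12) - 5 / (288 * x^3) + 343 / (8640 * x^4)
             - 2621 / (41472 * x^5) + a / x^6) - ln (1 / exp 1 * (1 + 1/x) powr x)) / x"
    and "0 < (x + 5/12) / (x + 11/12) - 5 / (288 * x^3) + 343 / (8640 * x^4)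
             - 2621 / (41472 * x^5) + a / x^6"
proof -
  define B where "B = (x + 5/12) / (x + 11/12) - 5 / (288 * x^3) + 343 / (8640 * x^4)
             - 2621 / (41472 * x^5) + a / x^6"
  define p where "p = - (5/288) * (1/x)^3 + 343/8640 * (1/x)^4 - 2621/41472 * (1/x)^5 + a * (1/x)^6"
  have x: "0 < x" using assms by simp
  have N: "0 < numer a (1/x)" using assms by (intro numer_pos) auto
  have D: "0 < 12 + 11 * (1/x)" using x by (simp add: add_pos_pos)
  have "B = (x + 5/12) / (x + 11/12) + p"
    by (simp add: B_def p_def power_divide)
  also have "(x + 5/12) / (x + 11/12) = (12 + 5 * (1/x)) / (12 + 11 * (1/x))"
    using x by (simp add: divide_simps) (simp add: algebra_simps)
  also have "\<dots> + p = numer a (1/x) / (12 + 11 * (1/x))"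
    using D unfolding numer_def p_def[symmetric] by (simp add: add_divide_distrib)
  finally have B: "B = numer a (1/x) / (12 + 11 * (1/x))" .
  then show "0 < B" using N D by simp
  have "ln B = ln (numer a (1/x)) - ln (12 + 11 * (1/x))"
    unfolding B using N D by (intro ln_divide_pos)
  moreover have "ln (1 / exp 1 * (1 + 1/x) powr x) = x * ln (1 + 1/x) - 1"
    using x add_pos_pos[of 1 "1/x"] by (simp add: ln_mult ln_div ln_powr)
  ultimately show "gap a (1/x) = (ln B - ln (1 / exp 1 * (1 + 1/x) powr x)) / x"
    using x by (simp add: gap_def field_simps)
qed

theorem theorem1:
  fixes x :: real
  assumes "x \<in> {1..}"
  shows "(x + 5/12) / (x + 11/12) - 5 / (288 * x^3) + 343 / (8640 * x^4) - 2621 / (41472 * x^5)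
           < 1 / exp 1 * (1 + 1/x) powr x
       \<and> 1 / exp 1 * (1 + 1/x) powr x
           < (x + 5/12) / (x + 11/12) - 5 / (288 * x^3) + 343 / (8640 * x^4) - 2621 / (41472 * x^5)
             + 300901 / (3483648 * x^6)"
proof -
  have x: "1 \<le> x" using assms by simp
  define y where "y = 1 / exp 1 * (1 + 1/x) powr x"
  define B where "B a = (x + 5/12) / (x + 11/12) - 5 / (288 * x^3) + 343 / (8640 * x^4)
             - 2621 / (41472 * x^5) + a / x^6" for a
  have "0 < 1 + 1/x" using x by (simp add: add_pos_pos)
  then have y: "0 < y" by (simp add: y_def)
  have B: "0 < B a" and gap: "gap a (1/x) = (ln (B a) - ln y) / x" if "0 \<le> a" for a
    using gap_inverse[OF x that] by (simp_all only: B_def y_def)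
  have t: "0 < 1/x" "1/x \<le> 1" using x by auto
  have "ln (B 0) < ln y"
    using gap_neg[OF t] gap[of 0] x by (simp add: divide_less_0_iff)
  moreover have "ln y < ln (B (300901/3483648))"
    using gap_pos[OF t] gap[of "300901/3483648"] x by (simp add: zero_less_divide_iff)
  ultimately have "B 0 < y \<and> y < B (300901/3483648)"
    using y B by simp
  then show ?thesis by (simp add: B_def y_def)
qed

end
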